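(* Let $H_2=(0,1)\times(-1,1)$ and $H_2^0=H_2\cup\{(0,0)\}\subset\mathbb{R}^2$. For $\mathbf{x}=(x_1,x_2),\mathbf{y}=(y_1,y_2)\in H_2^0$ define $$\mathbf{x}\bigoplus\mathbf{y}=\begin{cases}(0,0) & \text{if }\mathbf{x}=\mathbf{y}=(0,0),\\[4pt] \left(x_1\oplus y_1,\ \dfrac{x_1x_2\oplus y_1y_2}{x_1\oplus y_1}\right) & \text{otherwise},\end{cases}$$ where $s\oplus t=\dfrac{s+t}{1+st}$ for $s,t\in(-1,1)$. Define also, if $\mathbf{x},\mathbf{y}\in H_2$, $$\mathbf{x}\bigodot\mathbf{y}=\left(\tanh P,\ \frac{\tanh Q}{\tanh P}\right),$$ $$P=\operatorname{atanh}(x_1)\operatorname{atanh}(y_1)+\operatorname{atanh}(x_1x_2)\operatorname{atanh}(y_1y_2),$$ $$Q=\operatorname{atanh}(y_1)\operatorname{atanh}(x_1x_2)+\operatorname{atanh}(x_1)\operatorname{atanh}(y_1y_2),$$ and $\mathbf{x}\bigodot\mathbf{y}=(0,0)$ if $\mathbf{x}=(0,0)$ or $\mathbf{y}=(0,0)$. Then $\bigodot$ distributes over $\bigoplus$, $(H_2^0,\bigoplus)$ is a commutative monoid, and $(H_2,\bigodot)$ is a commutative group. Thus $(H_2^0,\bigoplus,\bigodot)$ is a semi-field with zero.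
   Context: A semi-field with zero is a set with two binary operations (addition and multiplication) and an element $0$ such that addition makes it a commutative monoid with identity $0$, multiplication makes the set of nonzero elements a group, $0$ is absorbing for multiplication, and multiplication distributes over addition on both sides. Here $\operatorname{atanh}:(-1,1)\to\mathbb{R}$ is the inverse of $\tanh$. *)

theory Defs
  imports Complex_Main "HOL-Algebra.Group"
begin

definition H2 :: "(real \<times> real) set" where
  "H2 = {0<..<1} \<times> {-1<..<1}"

definition H20 :: "(real \<times> real) set" where
  "H20 = H2 \<union> {(0, 0)}"

definition einstein_add :: "real \<Rightarrow> real \<Rightarrow> real" where
  "einstein_add s t = (s + t) / (1 + s * t)"

definition big_add :: "real \<times> real \<Rightarrow> real \<times> real \<Rightarrow> real \<times> real" where
  "big_add = (\<lambda>(x1, x2) (y1, y2).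
     if (x1, x2) = (0, 0) \<and> (y1, y2) = (0, 0) then (0, 0)
     else (einstein_add x1 y1, einstein_add (x1 * x2) (y1 * y2) / einstein_add x1 y1))"

definition big_mult :: "real \<times> real \<Rightarrow> real \<times> real \<Rightarrow> real \<times> real" where
  "big_mult = (\<lambda>(x1, x2) (y1, y2).
     if (x1, x2) = (0, 0) \<or> (y1, y2) = (0, 0) then (0, 0)
     else
       let P = artanh x1 * artanh y1 + artanh (x1 * x2) * artanh (y1 * y2);
           Q = artanh y1 * artanh (x1 * x2) + artanh x1 * artanh (y1 * y2)
       in (tanh P, tanh Q / tanh P))"

definition distributes_over ::
  "'a set \<Rightarrow> ('a \<Rightarrow> 'a \<Rightarrow> 'a) \<Rightarrow> ('a \<Rightarrow> 'a \<Rightarrow> 'a) \<Rightarrow> bool" where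
  "distributes_over S mul add \<longleftrightarrow>
     (\<forall>x\<in>S. \<forall>y\<in>S. \<forall>z\<in>S.
        mul x (add y z) = add (mul x y) (mul x z) \<and>
        mul (add y z) x = add (mul y x) (mul z x))"

definition semifield_with_zero ::
  "'a set \<Rightarrow> ('a \<Rightarrow> 'a \<Rightarrow> 'a) \<Rightarrow> ('a \<Rightarrow> 'a \<Rightarrow> 'a) \<Rightarrow> 'a \<Rightarrow> bool" where
  "semifield_with_zero S add mul z \<longleftrightarrow>
     (\<forall>x\<in>S. \<forall>y\<in>S. add x y \<in> S \<and> mul x y \<in> S) \<and>
     comm_monoid \<lparr>carrier = S, mult = add, one = z\<rparr> \<and>
     (\<exists>e. group \<lparr>carrier = S - {z}, mult = mul, one = e\<rparr>) \<and>
     (\<forall>x\<in>S. mul z x = z \<and> mul x z = z) \<and>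
     distributes_over S mul add"

end

theory Submission
  imports Defs
begin

text \<open>
  In the coordinates \<open>u = artanh x\<^sub>1 + artanh (x\<^sub>1 x\<^sub>2)\<close> and \<open>v = artanh x\<^sub>1 - artanh (x\<^sub>1 x\<^sub>2)\<close> both
  operations become componentwise: the addition theorem for tanh linearizes \<open>big_add\<close>, and
  \<open>P + Q\<close> and \<open>P - Q\<close> factor as the products of the \<open>u\<close>- and the \<open>v\<close>-coordinates. So the structure is
  the image of the positive quadrant together with the origin, and its laws are those of the reals.
\<close>

definition quadrant :: "(real \<times> real) set" where
  "quadrant = {0<..} \<times> {0<..}"

text \<open>Of the axes only the origin is kept: elsewhere on them the second coordinate of
  \<open>of_quadrant\<close> would be 1 or -1, and the point would have no inverse under
  componentwise multiplication.\<close>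

definition quadrant0 :: "(real \<times> real) set" where
  "quadrant0 = quadrant \<union> {(0, 0)}"

text \<open>This inverts the change of coordinates: (u + v) / 2 is \<open>artanh x1\<close> and (u -
  v) / 2 is \<open>artanh (x1 * x2)\<close>.\<close>

definition of_quadrant :: "real \<times> real \<Rightarrow> real \<times> real" where
  "of_quadrant = (\<lambda>(u, v). (tanh ((u + v) / 2), tanh ((u - v) / 2) / tanh ((u + v) / 2)))"

text \<open>The convention 0 / 0 = 0 lets the same formula cover the origin.\<close>

lemma of_quadrant_zero: "of_quadrant (0, 0) = (0, 0)"
  by (simp add: of_quadrant_def)

text \<open>Once x1 > 0, monotonicity of tanh turns -1 < x2 < 1 into -(u + v) < u - v < u + v, that
  is, u > 0 and v > 0.\<close>

lemma of_quadrant_mem_H2: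
  assumes "p \<in> quadrant"
  shows "of_quadrant p \<in> H2"
proof -
  obtain u v where p: "p = (u, v)" and "0 < u" "0 < v"
    using assms by (auto simp: quadrant_def)
  then have pos: "0 < tanh ((u + v) / 2)"
    by simp
  have "tanh ((u - v) / 2) < tanh ((u + v) / 2)"
    using \<open>0 < v\<close> by simp
  moreover have "tanh (- ((u + v) / 2)) < tanh ((u - v) / 2)"
    using \<open>0 < u\<close> by (simp only: tanh_real_less_iff) (simp add: field_simps)
  ultimately show ?thesis
    using pos by (simp add: p of_quadrant_def H2_def tanh_real_lt_1 field_simps)
qed

lemma tanh_artanh_real:
  assumes "\<bar>x\<bar> < 1"
  shows "tanh (artanh x) = (x::real)"
proof -
  have pos: "0 < (1 + x) / (1 - x)"
    using assms by (simp add: abs_less_iff)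
  have "tanh (artanh x) = (1 - inverse ((1 + x) / (1 - x))) / (1 + inverse ((1 + x) / (1 - x)))"
    unfolding tanh_real_altdef using pos by (simp add: artanh_def exp_minus)
  also have "\<dots> = x"
    using assms by (simp add: abs_less_iff field_simps)
  finally show ?thesis .
qed

lemma H2_eq_image: "H2 = of_quadrant ` quadrant"
proof
  show "of_quadrant ` quadrant \<subseteq> H2"
    using of_quadrant_mem_H2 by blast
next
  show "H2 \<subseteq> of_quadrant ` quadrant"
  proof
    fix x assume "x \<in> H2"
    then obtain x1 x2 where x: "x = (x1, x2)" and x1: "0 < x1" "x1 < 1" and x2: "\<bar>x2\<bar> < 1"
      by (auto simp: H2_def)
    define a where "a = artanh x1"
    define b where "b = artanh (x1 * x2)"
    \<comment> \<open>This bound serves twice: it keeps x1 * x2 in the domain of artanh, and under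
      tanh it becomes -a < b < a, the positivity of a + b and a - b.\<close>
    have less: "\<bar>x1 * x2\<bar> < x1"
      using x1 x2 by (simp add: abs_mult)
    have a: "tanh a = x1" and b: "tanh b = x1 * x2"
      using x1 less by (simp_all add: a_def b_def tanh_artanh_real)
    have "tanh b < tanh a" "tanh (- a) < tanh b"
      using less by (simp_all add: a b abs_less_iff)
    then have "b < a" "- a < b"
      by (simp_all only: tanh_real_less_iff)
    then have "(a + b, a - b) \<in> quadrant"
      by (simp add: quadrant_def)
    moreover have "of_quadrant (a + b, a - b) = x"
      using x1 by (simp add: of_quadrant_def a b x)
    ultimately show "x \<in> of_quadrant ` quadrant"
      by (metis imageI)
  qed
qed

lemma H20_eq_image: "H20 = of_quadrant ` quadrant0"
  by (simp add: H20_def quadrant0_def H2_eq_image of_quadrant_zero)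

lemma einstein_add_tanh: "einstein_add (tanh a) (tanh b) = tanh (a + b)"
  by (simp add: einstein_add_def tanh_add)

text \<open>The formulas of both operations involve x2 only through x1 * x2, which is recovered
  here. Off the origin the divisor is positive; at the origin both sides are 0.\<close>

lemma tanh_mult_of_quadrant:
  assumes "(a, b) \<in> quadrant0"
  shows "tanh ((a + b) / 2) * (tanh ((a - b) / 2) / tanh ((a + b) / 2)) = tanh ((a - b) / 2)"
  using assms by (auto simp: quadrant0_def quadrant_def)

lemma big_add_of_quadrant:
  assumes "(a, b) \<in> quadrant0" "(c, d) \<in> quadrant0"
  shows "big_add (of_quadrant (a, b)) (of_quadrant (c, d)) = of_quadrant (a + c, b + d)"
proof -
  have P: "(a + b) / 2 + (c + d) / 2 = (a + c + (b + d)) / 2"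
    by (simp add: field_simps)
  have Q: "(a - b) / 2 + (c - d) / 2 = (a + c - (b + d)) / 2"
    by (simp add: field_simps)
  show ?thesis
    unfolding big_add_def of_quadrant_def prod.case
      tanh_mult_of_quadrant[OF assms(1)] tanh_mult_of_quadrant[OF assms(2)]
      einstein_add_tanh P Q
    \<comment> \<open>Only the case split of \<open>big_add\<close> is left; its zero case occurs
      when both arguments are the origin, where the general formula also gives (0, 0).\<close>
    using assms by (auto simp: quadrant0_def quadrant_def)
qed

text \<open>For p = \<open>artanh x1\<close> and q = \<open>artanh (x1 * x2)\<close>, the pair (P,
  Q) is the product of split-complex numbers p + q j with j^2 = 1; the coordinates p + q and p - q
  diagonalize it.\<close>

lemma big_mult_of_quadrant:
  assumes "(a, b) \<in> quadrant0" "(c, d) \<in> quadrant0"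
  shows "big_mult (of_quadrant (a, b)) (of_quadrant (c, d)) = of_quadrant (a * c, b * d)"
proof -
  have P: "(a + b) / 2 * ((c + d) / 2) + (a - b) / 2 * ((c - d) / 2) = (a * c + b * d) / 2"
    by (simp add: field_simps)
  have Q: "(c + d) / 2 * ((a - b) / 2) + (a + b) / 2 * ((c - d) / 2) = (a * c - b * d) / 2"
    by (simp add: field_simps)
  show ?thesis
    unfolding big_mult_def of_quadrant_def prod.case
      tanh_mult_of_quadrant[OF assms(1)] tanh_mult_of_quadrant[OF assms(2)]
      artanh_tanh_real Let_def P Q
    using assms by (auto simp: quadrant0_def quadrant_def)
qed

lemma H2_cases:
  assumes "x \<in> H2"
  obtains u v where "x = of_quadrant (u, v)" "0 < u" "0 < v"
  using assms by (auto simp: H2_eq_image quadrant_def)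

lemma H20_cases:
  assumes "x \<in> H20"
  obtains u v where "x = of_quadrant (u, v)" "(u, v) \<in> quadrant0"
  using assms by (auto simp: H20_eq_image)

lemma quadrant0_add: "(a, b) \<in> quadrant0 \<Longrightarrow> (c, d) \<in> quadrant0 \<Longrightarrow> (a + c, b + d) \<in> quadrant0"
  by (auto simp: quadrant0_def quadrant_def)

lemma quadrant0_mult: "(a, b) \<in> quadrant0 \<Longrightarrow> (c, d) \<in> quadrant0 \<Longrightarrow> (a * c, b * d) \<in> quadrant0"
  by (auto simp: quadrant0_def quadrant_def)

lemma of_quadrant_mem_H20: "p \<in> quadrant0 \<Longrightarrow> of_quadrant p \<in> H20"
  by (simp add: H20_eq_image)

text \<open>The closure rules discharge the membership conditions of the two homomorphism rules in
  nested terms, so each law reduces to real arithmetic in the coordinates.\<close>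

lemmas of_quadrant_simps =
  big_add_of_quadrant big_mult_of_quadrant quadrant0_add quadrant0_mult of_quadrant_mem_H20

lemma distributes_over_H20: "distributes_over H20 big_mult big_add"
  unfolding distributes_over_def
  by (auto elim!: H20_cases simp: of_quadrant_simps algebra_simps)

lemma zero_mem_quadrant0: "(0, 0) \<in> quadrant0"
  by (simp add: quadrant0_def)

lemma comm_monoid_H20: "comm_monoid \<lparr>carrier = H20, mult = big_add, one = (0, 0)\<rparr>"
proof (rule comm_monoidI; simp)
  show "(0, 0) \<in> H20"
    by (simp add: H20_def)
  show "big_add x y \<in> H20" if "x \<in> H20" "y \<in> H20" for x y
    using that by (auto elim!: H20_cases simp: of_quadrant_simps)
  show "big_add (big_add x y) z = big_add x (big_add y z)"
    if "x \<in> H20" "y \<in> H20" "z \<in> H20" for x y z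
    using that by (auto elim!: H20_cases simp: of_quadrant_simps add.assoc)
  show "big_add (0, 0) x = x" if "x \<in> H20" for x
    using that big_add_of_quadrant[OF zero_mem_quadrant0]
    by (auto elim!: H20_cases simp: of_quadrant_zero)
  show "big_add x y = big_add y x" if "x \<in> H20" "y \<in> H20" for x y
    using that by (auto elim!: H20_cases simp: of_quadrant_simps add.commute)
qed

lemma quadrant0_of_pos: "0 < u \<Longrightarrow> 0 < v \<Longrightarrow> (u, v) \<in> quadrant0"
  by (simp add: quadrant0_def quadrant_def)

lemma of_quadrant_pos_mem_H2: "0 < u \<Longrightarrow> 0 < v \<Longrightarrow> of_quadrant (u, v) \<in> H2"
  by (simp add: of_quadrant_mem_H2 quadrant_def)

text \<open>The group is transported from pairs of positive reals; its unit is the point (tanh 1,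
  0).\<close>

lemma comm_group_H2: "comm_group \<lparr>carrier = H2, mult = big_mult, one = of_quadrant (1, 1)\<rparr>"
proof (rule comm_groupI; simp)
  note simps = big_mult_of_quadrant quadrant0_of_pos of_quadrant_pos_mem_H2
  show "of_quadrant (1, 1) \<in> H2"
    by (simp add: simps)
  show "big_mult x y \<in> H2" if "x \<in> H2" "y \<in> H2" for x y
    using that by (auto elim!: H2_cases simp: simps)
  show "big_mult (big_mult x y) z = big_mult x (big_mult y z)"
    if "x \<in> H2" "y \<in> H2" "z \<in> H2" for x y z
    using that by (auto elim!: H2_cases simp: simps mult.assoc)
  show "big_mult x y = big_mult y x" if "x \<in> H2" "y \<in> H2" for x y
    using that by (auto elim!: H2_cases simp: simps mult.commute)
  show "big_mult (of_quadrant (1, 1)) x = x" if "x \<in> H2" for x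
    using that by (auto elim!: H2_cases simp: simps)
  show "\<exists>y\<in>H2. big_mult y x = of_quadrant (1, 1)" if "x \<in> H2" for x
  proof -
    obtain u v where x: "x = of_quadrant (u, v)" and "0 < u" "0 < v"
      using \<open>x \<in> H2\<close> by (rule H2_cases)
    then show ?thesis
      by (intro bexI[of _ "of_quadrant (inverse u, inverse v)"]) (simp_all add: simps)
  qed
qed

theorem mainTheorem3:
  shows "distributes_over H20 big_mult big_add \<and>
    comm_monoid \<lparr>carrier = H20, mult = big_add, one = (0, 0)\<rparr> \<and>
    (\<exists>e. comm_group \<lparr>carrier = H2, mult = big_mult, one = e\<rparr>) \<and>
    semifield_with_zero H20 big_add big_mult (0, 0)"
proof -
  \<comment> \<open>The origin is outside \<open>H2\<close> because x1 > 0 there, so the nonzero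
    elements form exactly the group already found.\<close>
  have "H20 - {(0, 0)} = H2"
    by (auto simp: H20_def H2_def)
  then have "group \<lparr>carrier = H20 - {(0, 0)}, mult = big_mult, one = of_quadrant (1, 1)\<rparr>"
    using comm_group_H2 by (simp add: comm_group.axioms(2))
  moreover have "big_add x y \<in> H20 \<and> big_mult x y \<in> H20" if "x \<in> H20" "y \<in> H20" for x y
    using that by (auto elim!: H20_cases simp: of_quadrant_simps)
  moreover have "big_mult (0, 0) x = (0, 0) \<and> big_mult x (0, 0) = (0, 0)" for x
    by (simp add: big_mult_def split: prod.split)
  ultimately have "semifield_with_zero H20 big_add big_mult (0, 0)"
    unfolding semifield_with_zero_def using distributes_over_H20 comm_monoid_H20 by blast
  then show ?thesis
    using distributes_over_H20 comm_monoid_H20 comm_group_H2 by blast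
qed

end
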